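(* Let $N\ge1$, $p\in(1,\infty)$, and let $\Omega\subseteq\mathbb{R}^N$ be a bounded convex domain. Let $\varphi,\gamma:[0,\infty)\to[0,\infty)$ be convex $\Phi$-functions such that $\varphi(t)=t^p\ln(e+t)$ for all $t\ge0$ and there exists $\beta>0$ with $$\lim_{\ell\to\infty}\frac{\gamma(\ell\beta)}{\varphi(\ell\beta)}=\infty .$$ Then: (i) the embedding $X_{L_{\Delta_p}}(\Omega)\hookrightarrow L^\varphi(\Omega)$ is not compact; (ii) the embedding $X_{L_{\Delta_p}}(\Omega)\hookrightarrow L^\gamma(\Omega)$ is not continuous (that is, it is not the case that $X_{L_{\Delta_p}}(\Omega)$ is continuously embedded in $L^\gamma(\Omega)$).
   Context: Functions on $\Omega$ are extended by $0$ to $\mathbb{R}^N$. With $C_{N,p}:=\frac{p\,\Gamma(N/2)}{2\pi^{N/2}}$ and $[u]_{X_{L_{\Delta_p}}(\Omega)}^p:=C_{N,p}\iint_{x,y\in\mathbb{R}^N,\,|x-y|\le 1}\frac{|u(x)-u(y)|^p}{|x-y|^N}\,dx\,dy$ (here $\Gamma$ is the Gamma function), $X_{L_{\Delta_p}}(\Omega):=\{u\in L^p(\Omega): [u]_{X_{L_{\Delta_p}}(\Omega)}<\infty,\ u=0\text{ in }\mathbb{R}^N\setminus\Omega\}$, normed by $\|u\|_{X_{L_{\Delta_p}}(\Omega)}=(\|u\|_{L^p(\Omega)}^p+[u]_{X_{L_{\Delta_p}}(\Omega)}^p)^{1/p}$. A function $\vartheta:[0,\infty)\to[0,\infty]$ is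 a $\Phi$-function if it is increasing, $\vartheta(0)=0$, $\lim_{t\to0^+}\vartheta(t)=0$ and $\lim_{t\to\infty}\vartheta(t)=\infty$; it is a convex $\Phi$-function if moreover it is left-continuous and convex. For a convex $\Phi$-function $\vartheta$, let $\varrho_\vartheta(u):=\int_\Omega\vartheta(|u|)\,dx$ for measurable $u:\Omega\to\mathbb{R}$; the Orlicz space is $L^\vartheta(\Omega):=\{u \text{ measurable}:\varrho_\vartheta(\lambda u)<\infty\text{ for some }\lambda>0\}$ with the Luxemburg norm $\|u\|_\vartheta:=\inf\{\lambda>0:\varrho_\vartheta(u/\lambda)\le1\}$. *)

theory Defs
  imports "HOL-Analysis.Analysis"
begin

text \<open>
  \<open>\<real>\<^sup>N\<close> is a type \<open>'a :: euclidean_space\<close> with \<open>N = DIM('a)\<close>. Elements of the function spaces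
  are represented by functions, not by classes modulo equality almost everywhere, so the
  functionals called norms below are seminorms on these sets of representatives.
\<close>

definition C_Np :: "nat \<Rightarrow> real \<Rightarrow> real" where
  "C_Np N p = p * Gamma (real N / 2) / (2 * pi powr (real N / 2))"

text \<open>The \<open>p\<close>-th power of the seminorm. The double integral is taken with respect to Lebesgue
  measure on \<open>\<real>\<^sup>N \<times> \<real>\<^sup>N\<close>; on the diagonal, a null set, the integrand is \<open>0\<close> since \<open>x / 0 = 0\<close>.\<close>

definition X_seminorm_pow :: "real \<Rightarrow> ('a::euclidean_space \<Rightarrow> real) \<Rightarrow> ennreal" where
  "X_seminorm_pow p u =
     ennreal (C_Np DIM('a) p) *
     (\<integral>\<^sup>+z \<in> {z. norm (fst z - snd z) \<le> 1}.
        ennreal (\<bar>u (fst z) - u (snd z)\<bar> powr p / norm (fst z - snd z) ^ DIM('a))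
      \<partial>(lebesgue :: ('a \<times> 'a) measure))"

definition Lp_norm_pow :: "real \<Rightarrow> 'a::euclidean_space set \<Rightarrow> ('a \<Rightarrow> real) \<Rightarrow> ennreal" where
  "Lp_norm_pow p \<Omega> u = (\<integral>\<^sup>+x. ennreal (\<bar>u x\<bar> powr p) \<partial>(lebesgue_on \<Omega>))"

definition Lp_space :: "real \<Rightarrow> 'a::euclidean_space set \<Rightarrow> ('a \<Rightarrow> real) set" where
  "Lp_space p \<Omega> = {u \<in> borel_measurable (lebesgue_on \<Omega>). Lp_norm_pow p \<Omega> u < \<infinity>}"

definition X_space :: "real \<Rightarrow> 'a::euclidean_space set \<Rightarrow> ('a \<Rightarrow> real) set" where
  "X_space p \<Omega> = {u \<in> Lp_space p \<Omega>. X_seminorm_pow p u < \<infinity> \<and> (\<forall>x. x \<notin> \<Omega> \<longrightarrow> u x = 0)}"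

definition X_norm :: "real \<Rightarrow> 'a::euclidean_space set \<Rightarrow> ('a \<Rightarrow> real) \<Rightarrow> real" where
  "X_norm p \<Omega> u = (enn2real (Lp_norm_pow p \<Omega> u) + enn2real (X_seminorm_pow p u)) powr (1 / p)"

text \<open>Functions \<open>[0,\<infinity>) \<rightarrow> [0,\<infinity>]\<close> are represented by functions on \<open>real\<close> whose values at negative
  arguments are irrelevant.\<close>

definition Phi_function :: "(real \<Rightarrow> ennreal) \<Rightarrow> bool" where
  "Phi_function \<theta> \<longleftrightarrow>
     mono_on {0..} \<theta> \<and> \<theta> 0 = 0 \<and> (\<theta> \<longlongrightarrow> 0) (at_right 0) \<and> (\<theta> \<longlongrightarrow> \<infinity>) at_top"

definition convex_Phi_function :: "(real \<Rightarrow> ennreal) \<Rightarrow> bool" where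
  "convex_Phi_function \<theta> \<longleftrightarrow>
     Phi_function \<theta> \<and>
     (\<forall>t>0. continuous (at_left t) \<theta>) \<and>
     (\<forall>s\<ge>0. \<forall>t\<ge>0. \<forall>a\<in>{0..1}.
        \<theta> (a * s + (1 - a) * t) \<le> ennreal a * \<theta> s + ennreal (1 - a) * \<theta> t)"

definition Orlicz_modular ::
    "(real \<Rightarrow> ennreal) \<Rightarrow> 'a::euclidean_space set \<Rightarrow> ('a \<Rightarrow> real) \<Rightarrow> ennreal" where
  "Orlicz_modular \<theta> \<Omega> u = (\<integral>\<^sup>+x. \<theta> \<bar>u x\<bar> \<partial>(lebesgue_on \<Omega>))"

definition Orlicz_space ::
    "(real \<Rightarrow> ennreal) \<Rightarrow> 'a::euclidean_space set \<Rightarrow> ('a \<Rightarrow> real) set" where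
  "Orlicz_space \<theta> \<Omega> =
     {u \<in> borel_measurable (lebesgue_on \<Omega>).
        \<exists>c>0. Orlicz_modular \<theta> \<Omega> (\<lambda>x. c * u x) < \<infinity>}"

definition Luxemburg_norm ::
    "(real \<Rightarrow> ennreal) \<Rightarrow> 'a::euclidean_space set \<Rightarrow> ('a \<Rightarrow> real) \<Rightarrow> real" where
  "Luxemburg_norm \<theta> \<Omega> u = Inf {c. c > 0 \<and> Orlicz_modular \<theta> \<Omega> (\<lambda>x. u x / c) \<le> 1}"

definition continuously_embedded ::
    "('a \<Rightarrow> real) set \<Rightarrow> (('a \<Rightarrow> real) \<Rightarrow> real) \<Rightarrow>
     ('a \<Rightarrow> real) set \<Rightarrow> (('a \<Rightarrow> real) \<Rightarrow> real) \<Rightarrow> bool" where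
  "continuously_embedded X nX Y nY \<longleftrightarrow> X \<subseteq> Y \<and> (\<exists>C. \<forall>u\<in>X. nY u \<le> C * nX u)"

text \<open>The inclusion maps bounded sequences to sequences with a convergent subsequence; being
  linear, it is then automatically bounded.\<close>

definition compactly_embedded ::
    "('a \<Rightarrow> real) set \<Rightarrow> (('a \<Rightarrow> real) \<Rightarrow> real) \<Rightarrow>
     ('a \<Rightarrow> real) set \<Rightarrow> (('a \<Rightarrow> real) \<Rightarrow> real) \<Rightarrow> bool" where
  "compactly_embedded X nX Y nY \<longleftrightarrow>
     X \<subseteq> Y \<and>
     (\<forall>u :: nat \<Rightarrow> 'a \<Rightarrow> real. (\<forall>k. u k \<in> X) \<and> (\<exists>M. \<forall>k. nX (u k) \<le> M) \<longrightarrow>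
        (\<exists>r v. strict_mono (r :: nat \<Rightarrow> nat) \<and> v \<in> Y \<and>
           (\<lambda>k. nY (\<lambda>x. u (r k) x - v x)) \<longlonglongrightarrow> 0))"

end

theory Submission
  imports Defs "HOL-Real_Asymp.Real_Asymp"
begin

text \<open>
  Let \<open>u\<^sub>n\<close> be the tent of radius \<open>2\<^sup>-\<^sup>n\<close> at a point of \<open>\<Omega>\<close> whose height \<open>A\<^sub>n\<close> satisfies
  \<open>A\<^sub>n\<^sup>p = 2\<^sup>n\<^sup>N / (n + 1)\<close>. Each of the \<open>n\<close> dyadic annuli \<open>2\<^sup>-\<^sup>j\<^sup>-\<^sup>1 < |x - y| \<le> 2\<^sup>-\<^sup>j\<close> with \<open>j < n\<close>
  contributes about \<open>1 / (n + 1)\<close> to the seminorm and the smaller ones contribute a geometric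
  series, so \<open>u\<^sub>n\<close> is bounded in the energy space. Since \<open>ln A\<^sub>n\<close> grows like \<open>n\<close>, the integral of
  \<open>u\<^sub>n\<^sup>p ln (e + u\<^sub>n)\<close> stays bounded away from \<open>0\<close>; it blows up if \<open>\<phi>\<close> is replaced by \<open>\<gamma>\<close>.
  As the supports shrink to a point, no subsequence converges in \<open>L\<^sup>\<phi>\<close>.
\<close>

section \<open>Dyadic majorant of the singular kernel\<close>

text \<open>A step-function majorant of min(1, 2^n |h|) / |h|^N on the punctured unit ball.
  Coefficient \<open>j\<close> bounds this quotient on the annulus 2^-(j+1) < |h| <= 2^-j. Full
  balls in place of annuli only enlarge the sum, keep the integral of the same order, and have a
  known volume.\<close>

definition dyadic_kernel :: "nat \<Rightarrow> 'a::euclidean_space \<Rightarrow> ennreal" where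
  "dyadic_kernel n h =
     (\<Sum>j. ennreal (min 1 (2 ^ n / 2 ^ j) * 2 ^ (DIM('a) * Suc j)) * indicator (cball 0 (1 / 2 ^ j)) h)"

lemma sets_borel_cball [measurable]: "cball c r \<in> sets borel"
  by (simp add: borel_closed)

lemma measurable_dyadic_kernel [measurable]:
  "dyadic_kernel n \<in> borel_measurable (borel :: 'a::euclidean_space measure)"
  unfolding dyadic_kernel_def by measurable

lemma dyadic_kernel_minus: "dyadic_kernel n (x - y) = dyadic_kernel n (y - x)"
  by (simp add: dyadic_kernel_def indicator_def norm_minus_commute)

text \<open>The terms with j < n are all 1; from j = n on they form a geometric series with sum 2.
  This linear growth in \<open>n\<close> is what the factor 1 / (n + 1) in \<open>amplitude\<close>
  compensates.\<close>

lemma sums_min_dyadic: "(\<lambda>j. min 1 (2 ^ n / 2 ^ j)) sums (real n + 2)"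
proof -
  have "(\<lambda>j. min 1 (2 ^ n / 2 ^ (j + n))) = (\<lambda>j. (1 / 2 :: real) ^ j)"
    by (auto simp: power_add power_one_over divide_simps min_def fun_eq_iff intro: antisym)
  moreover have "(\<lambda>j. (1 / 2 :: real) ^ j) sums 2"
    using geometric_sums[of "1 / 2 :: real"] by simp
  moreover have "(\<Sum>j<n. min 1 (2 ^ n / 2 ^ j)) = (\<Sum>j<n. 1 :: real)"
    by (intro sum.cong refl) (auto simp: min_def field_simps power_increasing_iff)
  ultimately show ?thesis
    using sums_iff_shift[of "\<lambda>j. min 1 (2 ^ n / 2 ^ j :: real)" n 2]
    by (simp only:) (simp add: add.commute)
qed

text \<open>In term \<open>j\<close> the volume of the ball of radius 2^-j cancels 2^(N(j+1)) up to
  2^N, which leaves the series of \<open>sums_min_dyadic\<close>.\<close>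

lemma nn_integral_dyadic_kernel:
  "(\<integral>\<^sup>+h. dyadic_kernel n h \<partial>(lborel :: 'a::euclidean_space measure))
     = ennreal (unit_ball_vol (real DIM('a)) * 2 ^ DIM('a) * (real n + 2))"
proof -
  let ?V = "unit_ball_vol (real DIM('a))"
  have *: "ennreal (min 1 (2 ^ n / 2 ^ j) * 2 ^ (DIM('a) * Suc j))
        * emeasure lborel (cball (0::'a) (1 / 2 ^ j))
      = ennreal (?V * 2 ^ DIM('a) * min 1 (2 ^ n / 2 ^ j))" for j
  proof -
    have "(2::real) ^ (DIM('a) * Suc j) * (1 / 2 ^ j) ^ DIM('a) = 2 ^ DIM('a)"
      by (simp add: power_add power_mult[symmetric] power_one_over mult.commute field_simps)
    then have "min 1 (2 ^ n / 2 ^ j) * 2 ^ (DIM('a) * Suc j) * (?V * (1 / 2 ^ j) ^ DIM('a))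
      = ?V * 2 ^ DIM('a) * min 1 (2 ^ n / 2 ^ j)"
      by (simp only: mult.assoc mult.left_commute[of _ ?V]) (simp only: mult.commute[of "2 ^ DIM('a)"])
    then show ?thesis
      by (simp add: emeasure_cball ennreal_mult[symmetric] del: power_Suc mult_Suc_right)
  qed
  have "(\<integral>\<^sup>+h. dyadic_kernel n h \<partial>(lborel :: 'a measure))
      = (\<Sum>j. \<integral>\<^sup>+h. ennreal (min 1 (2 ^ n / 2 ^ j) * 2 ^ (DIM('a) * Suc j))
          * indicator (cball (0::'a) (1 / 2 ^ j)) h \<partial>lborel)"
    unfolding dyadic_kernel_def by (intro nn_integral_suminf) measurable
  also have "\<dots> = (\<Sum>j. ennreal (?V * 2 ^ DIM('a) * min 1 (2 ^ n / 2 ^ j)))"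
    by (subst nn_integral_cmult_indicator) (simp_all only: *, simp)
  also have "\<dots> = ennreal (?V * 2 ^ DIM('a) * (real n + 2))"
    by (intro suminf_ennreal_eq sums_mult sums_min_dyadic) simp
  finally show ?thesis .
qed

text \<open>Take the least \<open>j\<close> with 2^-(j+1) < t. The upper bound is minimality of
  \<open>j\<close>, or the hypothesis t <= 1 when j = 0.\<close>

lemma dyadic_scale:
  fixes t :: real
  assumes "0 < t" "t \<le> 1"
  obtains j :: nat where "1 / 2 ^ Suc j < t" "t \<le> 1 / 2 ^ j"
proof -
  define P where "P j \<longleftrightarrow> 1 / 2 ^ Suc j < t" for j :: nat
  obtain k :: nat where "(1 / 2) ^ k < t"
    using real_arch_pow_inv[of t "1 / 2"] assms by auto
  moreover have "1 / 2 ^ Suc k \<le> (1 / 2 :: real) ^ k"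
    by (simp add: power_one_over field_simps)
  ultimately have "P k"
    unfolding P_def by linarith
  then have "P (Least P)"
    by (rule LeastI)
  moreover have "t \<le> 1 / 2 ^ Least P"
  proof (cases "Least P")
    case (Suc i)
    then have "\<not> P i"
      using not_less_Least[of i P] by simp
    then show ?thesis
      by (simp add: P_def Suc)
  qed (use assms in simp)
  ultimately show ?thesis
    using that by (simp add: P_def)
qed

text \<open>All terms are nonnegative, so the one at the dyadic scale of |h| suffices: there 1 / |h|
  <= 2^(j+1) and 2^n |h| <= 2^n / 2^j.\<close>

lemma dyadic_kernel_ge:
  fixes h :: "'a::euclidean_space"
  assumes "norm h \<le> 1" "h \<noteq> 0"
  shows "ennreal (min 1 (2 ^ n * norm h) / norm h ^ DIM('a)) \<le> dyadic_kernel n h"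
proof -
  obtain j where j: "1 / 2 ^ Suc j < norm h" "norm h \<le> 1 / 2 ^ j"
    using dyadic_scale[of "norm h"] assms by auto
  define f where "f j = ennreal (min 1 (2 ^ n / 2 ^ j) * 2 ^ (DIM('a) * Suc j))
    * indicator (cball 0 (1 / 2 ^ j)) h" for j
  have "1 / norm h \<le> 2 ^ Suc j"
    using j(1) assms by (simp add: field_simps)
  then have "(1 / norm h) ^ DIM('a) \<le> (2 ^ Suc j) ^ DIM('a)"
    by (intro power_mono) auto
  then have "1 / norm h ^ DIM('a) \<le> 2 ^ (DIM('a) * Suc j)"
    by (metis power_one_over power_mult mult.commute)
  moreover have "min 1 (2 ^ n * norm h) \<le> min 1 (2 ^ n / 2 ^ j)"
    using mult_left_mono[OF j(2), of "2 ^ n"] by (intro min.mono) auto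
  ultimately have "min 1 (2 ^ n * norm h) * (1 / norm h ^ DIM('a))
      \<le> min 1 (2 ^ n / 2 ^ j) * 2 ^ (DIM('a) * Suc j)"
    by (intro mult_mono) auto
  then have "ennreal (min 1 (2 ^ n * norm h) / norm h ^ DIM('a)) \<le> f j"
    using j(2) by (simp add: f_def ennreal_leI)
  also have "\<dots> \<le> suminf f"
    using sum_le_suminf[of f "{j}"] by simp
  finally show ?thesis
    by (simp add: f_def[abs_def] dyadic_kernel_def)
qed

section \<open>Seminorm bound for functions of small support\<close>

lemma nn_integral_lborel_shift:
  fixes g :: "'a::euclidean_space \<Rightarrow> ennreal"
  assumes [measurable]: "g \<in> borel_measurable borel"
  shows "(\<integral>\<^sup>+x. g (x - y) \<partial>lborel) = (\<integral>\<^sup>+x. g x \<partial>lborel)"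
proof -
  have "(\<integral>\<^sup>+x. g x \<partial>distr lborel borel ((+) (- y))) = (\<integral>\<^sup>+x. g (- y + x) \<partial>lborel)"
    by (intro nn_integral_distr) auto
  then show ?thesis
    by (simp add: lborel_distr_plus)
qed

lemma C_Np_nonneg: "0 < N \<Longrightarrow> 0 \<le> p \<Longrightarrow> 0 \<le> C_Np N p"
  unfolding C_Np_def by (intro divide_nonneg_pos mult_nonneg_nonneg Gamma_real_nonneg) auto

text \<open>Only pairs with a point in \<open>B\<close> contribute. On these the integrand is at
  most A^p times the dyadic kernel of x - y, and integrating the other variable over the whole space
  leaves the kernel's integral times the measure of \<open>B\<close>.\<close>

lemma X_seminorm_pow_le:
  fixes u :: "'a::euclidean_space \<Rightarrow> real"
  assumes "1 < p" "0 \<le> A"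
    and [measurable]: "B \<in> sets borel"
    and supp: "\<And>x. x \<notin> B \<Longrightarrow> u x = 0"
    and lip: "\<And>x y. \<bar>u x - u y\<bar> \<le> A * min 1 (2 ^ n * norm (x - y))"
  shows "X_seminorm_pow p u \<le> ennreal (C_Np DIM('a) p * (A powr p * (2 *
      (unit_ball_vol (real DIM('a)) * 2 ^ DIM('a) * (real n + 2))))) * emeasure lborel B"
proof -
  let ?K = "dyadic_kernel n :: 'a \<Rightarrow> ennreal"
  let ?I = "unit_ball_vol (real DIM('a)) * 2 ^ DIM('a) * (real n + 2)"
  \<comment> \<open>The sum of the two indicators dominates the indicator of "x or y lies in B" and
    splits into two products to which Tonelli applies; this is the source of the factor 2.\<close>
  define G where
    "G z = ennreal (A powr p) * (?K (fst z - snd z) * (indicator B (fst z) + indicator B (snd z)))"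
    for z :: "'a \<times> 'a"
  have bound: "ennreal (\<bar>u (fst z) - u (snd z)\<bar> powr p / norm (fst z - snd z) ^ DIM('a))
      * indicator {z. norm (fst z - snd z) \<le> 1} z \<le> G z" for z
  proof -
    obtain x y where z: "z = (x, y)"
      by (cases z)
    show ?thesis
    proof (cases "x \<noteq> y \<and> norm (x - y) \<le> 1 \<and> (x \<in> B \<or> y \<in> B)")
      case True
      define m where "m = min 1 (2 ^ n * norm (x - y))"
      have m: "0 < m" "m \<le> 1"
        using True by (auto simp: m_def)
      have "\<bar>u x - u y\<bar> powr p \<le> (A * m) powr p"
        using lip[of x y] assms(1) by (intro powr_mono2) (auto simp: m_def)
      also have "\<dots> = A powr p * m powr p"
        using m assms by (simp add: powr_mult)
      \<comment> \<open>Since 0 < m <= 1 < p, the exponent drops to 1, the power of min(1, 2^n |h|)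
        that \<open>dyadic_kernel\<close> majorizes.\<close>
      also have "m powr p \<le> m powr 1"
        using m assms(1) by (intro powr_mono') auto
      finally have "\<bar>u x - u y\<bar> powr p \<le> A powr p * m"
        using m by (simp add: mult_left_mono)
      then have "\<bar>u x - u y\<bar> powr p / norm (x - y) ^ DIM('a)
          \<le> A powr p * (m / norm (x - y) ^ DIM('a))"
        by (simp add: divide_right_mono)
      then have "ennreal (\<bar>u x - u y\<bar> powr p / norm (x - y) ^ DIM('a))
          \<le> ennreal (A powr p) * ennreal (m / norm (x - y) ^ DIM('a))"
        using m by (simp add: ennreal_mult[symmetric] ennreal_leI)
      also have "\<dots> \<le> ennreal (A powr p) * (?K (x - y) * (indicator B x + indicator B y))"
      proof (intro mult_left_mono)
        have "ennreal (m / norm (x - y) ^ DIM('a)) * 1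
            \<le> ?K (x - y) * (indicator B x + indicator B y)"
          unfolding m_def using True
          by (intro mult_mono dyadic_kernel_ge) (auto simp: indicator_def)
        then show "ennreal (m / norm (x - y) ^ DIM('a))
            \<le> ?K (x - y) * (indicator B x + indicator B y)"
          by simp
      qed simp
      finally show ?thesis
        using True by (simp add: z G_def)
    next
      case False
      then have "u x = u y \<or> \<not> norm (x - y) \<le> 1"
        using supp by auto
      then show ?thesis
        by (auto simp: z)
    qed
  qed
  have K1: "(\<integral>\<^sup>+x. ?K (x - y) \<partial>lborel) = ennreal ?I" for y
    using nn_integral_lborel_shift[of ?K y] by (simp add: nn_integral_dyadic_kernel)
  have K2: "(\<integral>\<^sup>+y. ?K (x - y) \<partial>lborel) = ennreal ?I" for x
    by (subst dyadic_kernel_minus) (rule K1)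
  \<comment> \<open>The variable not confined to \<open>B\<close> is integrated first; by
    translation invariance the inner integral is a constant.\<close>
  have i1: "(\<integral>\<^sup>+z. ?K (fst z - snd z) * indicator B (fst z) \<partial>(lborel \<Otimes>\<^sub>M lborel))
      = ennreal ?I * emeasure lborel B"
    by (subst lborel.nn_integral_fst[symmetric])
       (simp_all add: nn_integral_multc K2 nn_integral_cmult)
  have i2: "(\<integral>\<^sup>+z. ?K (fst z - snd z) * indicator B (snd z) \<partial>(lborel \<Otimes>\<^sub>M lborel))
      = ennreal ?I * emeasure lborel B"
    by (subst lborel_pair.nn_integral_snd[symmetric])
       (simp_all add: nn_integral_multc K1 nn_integral_cmult)
  have "X_seminorm_pow p u \<le> ennreal (C_Np DIM('a) p) * (\<integral>\<^sup>+z. G z \<partial>lborel)"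
    unfolding X_seminorm_pow_def nn_integral_completion
    by (intro mult_left_mono nn_integral_mono bound) simp
  also have "(\<integral>\<^sup>+z. G z \<partial>lborel) = (\<integral>\<^sup>+z. G z \<partial>(lborel \<Otimes>\<^sub>M lborel))"
    by (simp add: lborel_prod)
  also have "\<dots> = ennreal (A powr p) * (2 * (ennreal ?I * emeasure lborel B))"
    unfolding G_def
    by (subst nn_integral_cmult)
       (simp_all add: distrib_left nn_integral_add i1 i2 mult_2)
  also have "ennreal (C_Np DIM('a) p) * \<dots>
      = ennreal (C_Np DIM('a) p * (A powr p * (2 * ?I))) * emeasure lborel B"
    using assms C_Np_nonneg[of "DIM('a)" p]
    by (simp add: ennreal_mult mult_ac)
  finally show ?thesis .
qed

section \<open>Orlicz modulars and Luxemburg norms\<close>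

lemma Phi_functionD_mono: "Phi_function \<theta> \<Longrightarrow> 0 \<le> s \<Longrightarrow> s \<le> t \<Longrightarrow> \<theta> s \<le> \<theta> t"
  by (auto simp: Phi_function_def mono_on_def)

lemma convex_Phi_function_imp_Phi: "convex_Phi_function \<theta> \<Longrightarrow> Phi_function \<theta>"
  by (simp add: convex_Phi_function_def)

text \<open>Convexity between \<open>t\<close> and 0, where the function vanishes.\<close>

lemma convex_Phi_function_scale:
  assumes "convex_Phi_function \<theta>" "0 \<le> t" "0 \<le> a" "a \<le> 1"
  shows "\<theta> (a * t) \<le> ennreal a * \<theta> t"
proof -
  have "\<theta> (a * t + (1 - a) * 0) \<le> ennreal a * \<theta> t + ennreal (1 - a) * \<theta> 0"
    using assms unfolding convex_Phi_function_def by (meson atLeastAtMost_iff order_refl)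
  then show ?thesis
    using assms by (simp add: convex_Phi_function_def Phi_function_def)
qed

text \<open>Values at negative arguments are arbitrary, so \<open>\<theta>\<close> itself may fail
  to be measurable. Precomposed with \<open>max 0\<close> it is monotone, and its superlevel sets
  are intervals.\<close>

lemma Phi_function_measurable_abs:
  assumes "Phi_function \<theta>" and [measurable]: "u \<in> borel_measurable M"
  shows "(\<lambda>x. \<theta> \<bar>u x :: real\<bar>) \<in> borel_measurable M"
proof -
  have "(\<lambda>t. \<theta> (max 0 t)) \<in> borel_measurable borel"
  proof (rule borel_measurableI_greater)
    fix y
    have "is_interval {t. y < \<theta> (max 0 t)}"
      unfolding is_interval_1
      using Phi_functionD_mono[OF assms(1)]
      by (auto elim!: order_less_le_trans)
    then show "{t \<in> space borel. y < \<theta> (max 0 t)} \<in> sets borel"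
      by (simp add: real_interval_borel_measurable)
  qed
  then have "(\<lambda>x. \<theta> (max 0 \<bar>u x\<bar>)) \<in> borel_measurable M"
    by (rule measurable_compose_rev) measurable
  then show ?thesis
    by simp
qed

text \<open>Membership gives a scale with finite modular \<open>m\<close>; shrinking by a further
  factor 1 / (1 + m) brings it down to at most m / (1 + m) by convexity. Hence the infimum in
  \<open>Luxemburg_norm\<close> is over a nonempty set.\<close>

lemma Orlicz_spaceD_modular_le_1:
  assumes "convex_Phi_function \<theta>" "w \<in> Orlicz_space \<theta> \<Omega>"
  obtains c where "0 < c" "Orlicz_modular \<theta> \<Omega> (\<lambda>x. w x / c) \<le> 1"
proof -
  obtain c where c: "0 < c" "Orlicz_modular \<theta> \<Omega> (\<lambda>x. c * w x) < \<infinity>"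
    and w [measurable]: "w \<in> borel_measurable (lebesgue_on \<Omega>)"
    using assms(2) by (auto simp: Orlicz_space_def)
  have [measurable]: "(\<lambda>x. \<theta> \<bar>c * w x\<bar>) \<in> borel_measurable (lebesgue_on \<Omega>)"
    using assms(1) by (intro Phi_function_measurable_abs convex_Phi_function_imp_Phi) measurable
  obtain m where m: "0 \<le> m" "Orlicz_modular \<theta> \<Omega> (\<lambda>x. c * w x) = ennreal m"
    using c(2) by (cases "Orlicz_modular \<theta> \<Omega> (\<lambda>x. c * w x)") auto
  define a where "a = 1 / (1 + m)"
  have a: "0 < a" "a \<le> 1" "a * m \<le> 1"
    using m(1) by (auto simp: a_def)
  have "Orlicz_modular \<theta> \<Omega> (\<lambda>x. w x / (1 / (a * c)))
      \<le> (\<integral>\<^sup>+x. ennreal a * \<theta> \<bar>c * w x\<bar> \<partial>lebesgue_on \<Omega>)"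
    unfolding Orlicz_modular_def
  proof (intro nn_integral_mono)
    fix x
    have "\<bar>w x / (1 / (a * c))\<bar> = a * \<bar>c * w x\<bar>"
      using a c by (simp add: abs_mult)
    then show "\<theta> \<bar>w x / (1 / (a * c))\<bar> \<le> ennreal a * \<theta> \<bar>c * w x\<bar>"
      using convex_Phi_function_scale[OF assms(1), of "\<bar>c * w x\<bar>" a] a by simp
  qed
  also have "\<dots> = ennreal a * Orlicz_modular \<theta> \<Omega> (\<lambda>x. c * w x)"
    by (simp add: nn_integral_cmult Orlicz_modular_def)
  also have "\<dots> \<le> 1"
    using a m by (simp add: ennreal_mult[symmetric])
  finally show ?thesis
    using that[of "1 / (a * c)"] a c by simp
qed

lemma Orlicz_modular_mono:
  assumes "Phi_function \<theta>" "\<And>x. \<bar>u x\<bar> \<le> \<bar>w x\<bar>"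
  shows "Orlicz_modular \<theta> \<Omega> u \<le> Orlicz_modular \<theta> \<Omega> w"
  unfolding Orlicz_modular_def by (intro nn_integral_mono Phi_functionD_mono assms) simp

text \<open>Membership in the space matters: \<open>Inf {}\<close> is unspecified, so a small
  \<^const>\<open>Luxemburg_norm\<close> says nothing about functions outside it.\<close>

lemma Orlicz_modular_le_1:
  assumes "convex_Phi_function \<theta>" "w \<in> Orlicz_space \<theta> \<Omega>" "Luxemburg_norm \<theta> \<Omega> w < d"
  shows "Orlicz_modular \<theta> \<Omega> (\<lambda>x. w x / d) \<le> 1"
proof -
  let ?S = "{c. c > 0 \<and> Orlicz_modular \<theta> \<Omega> (\<lambda>x. w x / c) \<le> 1}"
  have "?S \<noteq> {}"
    using Orlicz_spaceD_modular_le_1[OF assms(1,2)] by blast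
  moreover have "bdd_below ?S"
    by (rule bdd_belowI[of _ 0]) simp
  ultimately obtain c where c: "0 < c" "c < d" "Orlicz_modular \<theta> \<Omega> (\<lambda>x. w x / c) \<le> 1"
    using assms(3) cInf_less_iff[of ?S d] by (auto simp: Luxemburg_norm_def)
  have "Orlicz_modular \<theta> \<Omega> (\<lambda>x. w x / d) \<le> Orlicz_modular \<theta> \<Omega> (\<lambda>x. w x / c)"
    using c by (intro Orlicz_modular_mono convex_Phi_function_imp_Phi assms(1))
      (simp add: frac_le)
  then show ?thesis
    using c(3) by simp
qed

text \<open>With \<open>e\<close> half the smaller scale, |e (u - w)| is at most the larger of |c u|
  and |d w|, so monotonicity bounds its modular by the sum of the two modulars.\<close>

lemma Orlicz_space_diff:
  assumes "Phi_function \<theta>" "u \<in> Orlicz_space \<theta> \<Omega>" "w \<in> Orlicz_space \<theta> \<Omega>"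
  shows "(\<lambda>x. u x - w x) \<in> Orlicz_space \<theta> \<Omega>"
proof -
  obtain c d where c: "0 < c" "Orlicz_modular \<theta> \<Omega> (\<lambda>x. c * u x) < \<infinity>"
    and d: "0 < d" "Orlicz_modular \<theta> \<Omega> (\<lambda>x. d * w x) < \<infinity>"
    and [measurable]: "u \<in> borel_measurable (lebesgue_on \<Omega>)" "w \<in> borel_measurable (lebesgue_on \<Omega>)"
    using assms(2,3) by (auto simp: Orlicz_space_def)
  define e where "e = min c d / 2"
  have e: "0 < e" "2 * e \<le> c" "2 * e \<le> d"
    using c(1) d(1) by (auto simp: e_def)
  have "Orlicz_modular \<theta> \<Omega> (\<lambda>x. e * (u x - w x))
      \<le> (\<integral>\<^sup>+x. \<theta> \<bar>c * u x\<bar> + \<theta> \<bar>d * w x\<bar> \<partial>lebesgue_on \<Omega>)"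
    unfolding Orlicz_modular_def
  proof (intro nn_integral_mono)
    fix x
    have *: "2 * e * \<bar>u x\<bar> \<le> \<bar>c * u x\<bar>" "2 * e * \<bar>w x\<bar> \<le> \<bar>d * w x\<bar>"
      using e c(1) d(1) by (auto simp: abs_mult intro!: mult_right_mono)
    have "\<bar>e * (u x - w x)\<bar> \<le> e * \<bar>u x\<bar> + e * \<bar>w x\<bar>"
      using e(1) abs_triangle_ineq4[of "u x" "w x"]
      by (simp add: abs_mult distrib_left[symmetric])
    then have "\<bar>e * (u x - w x)\<bar> \<le> \<bar>c * u x\<bar> \<or> \<bar>e * (u x - w x)\<bar> \<le> \<bar>d * w x\<bar>"
      using * by linarith
    then have "\<theta> \<bar>e * (u x - w x)\<bar> \<le> \<theta> \<bar>c * u x\<bar> \<or> \<theta> \<bar>e * (u x - w x)\<bar> \<le> \<theta> \<bar>d * w x\<bar>"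
      by (auto intro: Phi_functionD_mono[OF assms(1)])
    then show "\<theta> \<bar>e * (u x - w x)\<bar> \<le> \<theta> \<bar>c * u x\<bar> + \<theta> \<bar>d * w x\<bar>"
      by (auto intro: order_trans)
  qed
  also have "\<dots> = Orlicz_modular \<theta> \<Omega> (\<lambda>x. c * u x) + Orlicz_modular \<theta> \<Omega> (\<lambda>x. d * w x)"
    unfolding Orlicz_modular_def
    by (intro nn_integral_add Phi_function_measurable_abs assms(1)) measurable
  also have "\<dots> < \<infinity>"
    using c d by simp
  finally show ?thesis
    unfolding Orlicz_space_def using e(1) by auto
qed

section \<open>The bumps and their bounds in the energy space\<close>

definition amplitude :: "real \<Rightarrow> nat \<Rightarrow> nat \<Rightarrow> real" where
  "amplitude p N n = (2 ^ (n * N) / (real n + 1)) powr (1 / p)"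

definition bump :: "real \<Rightarrow> 'a::euclidean_space \<Rightarrow> nat \<Rightarrow> 'a \<Rightarrow> real" where
  "bump p a n x = amplitude p DIM('a) n * max 0 (1 - 2 ^ n * norm (x - a))"

lemma amplitude_pos: "0 < amplitude p N n"
  by (simp add: amplitude_def)

lemma amplitude_powr: "p \<noteq> 0 \<Longrightarrow> amplitude p N n powr p = 2 ^ (n * N) / (real n + 1)"
  by (simp add: amplitude_def powr_powr)

lemma ln_amplitude: "ln (amplitude p N n) = (real n * (real N * ln 2) - ln (real n + 1)) / p"
  by (simp add: amplitude_def ln_powr ln_div ln_realpow)

lemma bump_nonneg: "0 \<le> bump p a n x"
  using amplitude_pos[of p "DIM('a)" n] by (simp add: bump_def)

lemma bump_le: "bump p a n (x :: 'a::euclidean_space) \<le> amplitude p DIM('a) n"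
  using amplitude_pos[of p "DIM('a)" n] by (simp add: bump_def max_def mult_le_cancel_left2)

lemma bump_eq_0: "x \<notin> ball a (1 / 2 ^ n) \<Longrightarrow> bump p a n x = 0"
  by (simp add: bump_def dist_norm norm_minus_commute field_simps)

lemma bump_ge:
  assumes "x \<in> ball a (1 / 2 ^ Suc n)"
  shows "amplitude p DIM('a) n / 2 \<le> bump p a n (x :: 'a::euclidean_space)"
proof -
  have "1 / 2 \<le> max 0 (1 - 2 ^ n * norm (x - a))"
    using assms by (simp add: dist_norm norm_minus_commute field_simps)
  then have "amplitude p DIM('a) n * (1 / 2) \<le> bump p a n x"
    unfolding bump_def by (intro mult_left_mono less_imp_le[OF amplitude_pos])
  then show ?thesis
    by simp
qed

lemma measurable_bump [measurable]: "bump p a n \<in> borel_measurable borel"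
  unfolding bump_def by measurable

text \<open>The profile \<open>max 0 (1 - s)\<close> is 1-Lipschitz and, for s >= 0, takes values in
  [0, 1]. The first fact gives the bound linear in the distance, the second the bound 1.\<close>

lemma bump_diff_le:
  fixes x y :: "'a::euclidean_space"
  shows "\<bar>bump p a n x - bump p a n y\<bar> \<le> amplitude p DIM('a) n * min 1 (2 ^ n * norm (x - y))"
proof -
  define s t where "s = 2 ^ n * norm (x - a)" and "t = 2 ^ n * norm (y - a)"
  have "\<bar>norm (x - a) - norm (y - a)\<bar> \<le> norm (x - y)"
    using norm_triangle_ineq3[of "x - a" "y - a"] by simp
  then have "2 ^ n * \<bar>norm (x - a) - norm (y - a)\<bar> \<le> 2 ^ n * norm (x - y)"
    by (intro mult_left_mono) auto
  moreover have "\<bar>s - t\<bar> = 2 ^ n * \<bar>norm (x - a) - norm (y - a)\<bar>"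
    unfolding s_def t_def by (simp add: abs_mult right_diff_distrib[symmetric])
  moreover have "0 \<le> s" "0 \<le> t"
    by (auto simp: s_def t_def)
  ultimately have "\<bar>max 0 (1 - s) - max 0 (1 - t)\<bar> \<le> min 1 (2 ^ n * norm (x - y))"
    by linarith
  then have "amplitude p DIM('a) n * \<bar>max 0 (1 - s) - max 0 (1 - t)\<bar>
      \<le> amplitude p DIM('a) n * min 1 (2 ^ n * norm (x - y))"
    by (intro mult_left_mono less_imp_le[OF amplitude_pos])
  moreover have "\<bar>bump p a n x - bump p a n y\<bar>
      = amplitude p DIM('a) n * \<bar>max 0 (1 - s) - max 0 (1 - t)\<bar>"
    using amplitude_pos[of p "DIM('a)" n]
    by (simp add: bump_def s_def t_def right_diff_distrib[symmetric] abs_mult)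
  ultimately show ?thesis
    by simp
qed

text \<open>A^p times the volume of the supporting ball is V / (n + 1), while the dyadic kernel
  contributes n + 2. The product stays bounded in \<open>n\<close>; the 4 comes from 2 (n + 2) / (n
  + 1) <= 4.\<close>

lemma bump_X_seminorm_pow_le:
  fixes a :: "'a::euclidean_space"
  assumes "1 < p"
  shows "X_seminorm_pow p (bump p a n)
    \<le> ennreal (C_Np DIM('a) p * (4 * (unit_ball_vol (real DIM('a)))\<^sup>2 * 2 ^ DIM('a)))"
proof -
  let ?V = "unit_ball_vol (real DIM('a))" and ?C = "C_Np DIM('a) p"
  let ?A = "amplitude p DIM('a) n"
  have C: "0 \<le> ?C"
    using assms by (intro C_Np_nonneg) auto
  have ap: "?A powr p * (1 / 2 ^ n) ^ DIM('a) = 1 / (real n + 1)"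
    using assms by (simp add: amplitude_powr power_one_over power_mult)
  have "X_seminorm_pow p (bump p a n)
      \<le> ennreal (?C * (?A powr p * (2 * (?V * 2 ^ DIM('a) * (real n + 2)))))
        * emeasure lborel (ball a (1 / 2 ^ n))"
    using assms by (intro X_seminorm_pow_le bump_diff_le less_imp_le amplitude_pos bump_eq_0) auto
  also have "\<dots> = ennreal ((?C * (?A powr p * (2 * (?V * 2 ^ DIM('a) * (real n + 2)))))
      * (?V * (1 / 2 ^ n) ^ DIM('a)))"
    using C by (simp add: emeasure_ball ennreal_mult)
  also have "(?C * (?A powr p * (2 * (?V * 2 ^ DIM('a) * (real n + 2))))) * (?V * (1 / 2 ^ n) ^ DIM('a))
      = ?C * (?V\<^sup>2 * 2 ^ DIM('a)) * (2 * (real n + 2) * (?A powr p * (1 / 2 ^ n) ^ DIM('a)))"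
    by (simp add: power2_eq_square)
  also have "\<dots> \<le> ?C * (?V\<^sup>2 * 2 ^ DIM('a)) * 4"
    unfolding ap using C by (intro mult_left_mono) (auto simp: field_simps)
  finally show ?thesis
    by (simp add: mult_ac ennreal_leI)
qed

lemma bump_Lp_norm_pow_le:
  fixes a :: "'a::euclidean_space"
  assumes "1 < p" "\<Omega> \<in> sets lebesgue"
  shows "Lp_norm_pow p \<Omega> (bump p a n) \<le> ennreal (unit_ball_vol (real DIM('a)))"
proof -
  let ?V = "unit_ball_vol (real DIM('a))"
  let ?A = "amplitude p DIM('a) n"
  have "Lp_norm_pow p \<Omega> (bump p a n)
      = (\<integral>\<^sup>+x. ennreal (\<bar>bump p a n x\<bar> powr p) * indicator \<Omega> x \<partial>lebesgue)"
    using assms(2) by (simp add: Lp_norm_pow_def nn_integral_restrict_space)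
  also have "\<dots> \<le> (\<integral>\<^sup>+x. ennreal (?A powr p) * indicator (ball a (1 / 2 ^ n)) x \<partial>lebesgue)"
  proof (intro nn_integral_mono)
    fix x
    show "ennreal (\<bar>bump p a n x\<bar> powr p) * indicator \<Omega> x
        \<le> ennreal (?A powr p) * indicator (ball a (1 / 2 ^ n)) x"
    proof (cases "x \<in> ball a (1 / 2 ^ n)")
      case True
      have "\<bar>bump p a n x\<bar> powr p \<le> ?A powr p"
        using assms(1) bump_nonneg[of p a n x] bump_le[of p a n x] by (intro powr_mono2) auto
      then show ?thesis
        using True by (auto simp: indicator_def ennreal_leI)
    qed (simp add: bump_eq_0)
  qed
  also have "\<dots> = ennreal (?A powr p) * emeasure lborel (ball a (1 / 2 ^ n))"
    by (simp add: nn_integral_cmult_indicator)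
  also have "\<dots> = ennreal (?V * (?A powr p * (1 / 2 ^ n) ^ DIM('a)))"
    by (simp add: emeasure_ball ennreal_mult[symmetric] mult_ac)
  also have "\<dots> \<le> ennreal (?V * 1)"
    using assms(1)
    by (intro ennreal_leI mult_left_mono) (auto simp: amplitude_powr power_one_over power_mult)
  finally show ?thesis
    by simp
qed

lemma measurable_bump_lebesgue_on: "bump p a n \<in> borel_measurable (lebesgue_on \<Omega>)"
  by (intro measurable_restrict_space1 measurable_completion) simp

lemma bump_in_X_space:
  assumes "1 < p" "\<Omega> \<in> sets lebesgue" "ball a (1 / 2 ^ n) \<subseteq> \<Omega>"
  shows "bump p a n \<in> X_space p \<Omega>"
proof -
  have "X_seminorm_pow p (bump p a n) < \<infinity>" "Lp_norm_pow p \<Omega> (bump p a n) < \<infinity>"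
    using bump_X_seminorm_pow_le[OF assms(1), of a n] bump_Lp_norm_pow_le[OF assms(1,2), of a n]
    by (auto simp: less_top[symmetric] top_unique)
  moreover have "bump p a n x = 0" if "x \<notin> \<Omega>" for x
    using that assms(3) by (intro bump_eq_0) auto
  ultimately show ?thesis
    by (auto simp: X_space_def Lp_space_def measurable_bump_lebesgue_on)
qed

lemma bump_X_norm_le:
  assumes "1 < p" "\<Omega> \<in> sets lebesgue"
  obtains M where "0 \<le> M" "\<And>n. X_norm p \<Omega> (bump p (a::'a::euclidean_space) n) \<le> M"
proof -
  let ?V = "unit_ball_vol (real DIM('a))"
  let ?S = "C_Np DIM('a) p * (4 * ?V\<^sup>2 * 2 ^ DIM('a))"
  have "0 \<le> ?S"
    using assms by (intro mult_nonneg_nonneg C_Np_nonneg) auto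
  then have "enn2real (X_seminorm_pow p (bump p a n)) \<le> ?S" for n
    using bump_X_seminorm_pow_le[OF assms(1), of a n] by (intro enn2real_leI) auto
  moreover have "enn2real (Lp_norm_pow p \<Omega> (bump p a n)) \<le> ?V" for n
    using bump_Lp_norm_pow_le[OF assms, of a n] by (intro enn2real_leI) auto
  ultimately have "X_norm p \<Omega> (bump p a n) \<le> (?V + ?S) powr (1 / p)" for n
    unfolding X_norm_def using assms by (intro powr_mono2 add_mono) auto
  then show ?thesis
    using that[of "(?V + ?S) powr (1 / p)"] by simp
qed

section \<open>Orlicz modulars of the bumps\<close>

lemma bump_in_Orlicz_space:
  assumes "Phi_function (\<lambda>t. ennreal (f t))" "\<Omega> \<in> sets lebesgue" "bounded \<Omega>"
  shows "bump p (a::'a::euclidean_space) n \<in> Orlicz_space (\<lambda>t. ennreal (f t)) \<Omega>"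
proof -
  have "Orlicz_modular (\<lambda>t. ennreal (f t)) \<Omega> (bump p a n)
      \<le> (\<integral>\<^sup>+x. ennreal (f (amplitude p DIM('a) n)) \<partial>lebesgue_on \<Omega>)"
    unfolding Orlicz_modular_def
    using bump_le[of p a n] bump_nonneg[of p a n]
    by (intro nn_integral_mono Phi_functionD_mono[OF assms(1)]) auto
  also have "\<dots> = ennreal (f (amplitude p DIM('a) n)) * emeasure lebesgue \<Omega>"
    using assms(2) by (simp add: emeasure_restrict_space)
  also have "\<dots> < \<infinity>"
    using emeasure_bounded_finite[OF assms(3)] bounded_set_imp_lmeasurable[OF assms(3,2)]
    by (auto simp: ennreal_mult_less_top fmeasurable_def)
  finally have "Orlicz_modular (\<lambda>t. ennreal (f t)) \<Omega> (\<lambda>x. 1 * bump p a n x) < \<infinity>"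
    by simp
  then show ?thesis
    unfolding Orlicz_space_def using measurable_bump_lebesgue_on zero_less_one by blast
qed

text \<open>On the ball of half the radius the tent has at least half its height; the second factor
  is the volume of that ball.\<close>

lemma Orlicz_modular_bump_ge:
  fixes a :: "'a::euclidean_space"
  assumes "Phi_function \<theta>" "\<Omega> \<in> sets lebesgue" "ball a (1 / 2 ^ n) \<subseteq> \<Omega>" "0 < d"
  shows "\<theta> (amplitude p DIM('a) n / (2 * d)) * ennreal (unit_ball_vol (real DIM('a)) / 2 ^ (Suc n * DIM('a)))
    \<le> Orlicz_modular \<theta> \<Omega> (\<lambda>x. bump p a n x / d)"
proof -
  let ?c = "\<theta> (amplitude p DIM('a) n / (2 * d))"
  let ?B = "ball a (1 / 2 ^ Suc n)"
  have "?B \<subseteq> ball a (1 / 2 ^ n)"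
    by (intro subset_ball) (simp add: field_simps)
  then have sub: "?B \<subseteq> \<Omega>"
    using assms(3) by blast
  have "?c * ennreal (unit_ball_vol (real DIM('a)) / 2 ^ (Suc n * DIM('a)))
      = ?c * emeasure lebesgue ?B"
    by (simp add: emeasure_ball power_one_over power_mult del: power_Suc mult_Suc)
  also have "\<dots> = (\<integral>\<^sup>+x. ?c * indicator ?B x \<partial>lebesgue)"
    by (simp add: nn_integral_cmult_indicator)
  also have "\<dots> \<le> (\<integral>\<^sup>+x. \<theta> \<bar>bump p a n x / d\<bar> * indicator \<Omega> x \<partial>lebesgue)"
  proof (intro nn_integral_mono)
    fix x
    show "?c * indicator ?B x \<le> \<theta> \<bar>bump p a n x / d\<bar> * indicator \<Omega> x"
    proof (cases "x \<in> ?B")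
      case True
      have "amplitude p DIM('a) n / 2 / d \<le> bump p a n x / d"
        using bump_ge[OF True, of p] assms(4) by (intro divide_right_mono) auto
      then have "?c \<le> \<theta> \<bar>bump p a n x / d\<bar>"
        using assms(4) amplitude_pos[of p "DIM('a)" n] bump_nonneg[of p a n x]
        by (intro Phi_functionD_mono[OF assms(1)]) auto
      then show ?thesis
        using True sub by (auto simp: indicator_def)
    qed simp
  qed
  also have "\<dots> = Orlicz_modular \<theta> \<Omega> (\<lambda>x. bump p a n x / d)"
    using assms(2) by (simp add: Orlicz_modular_def nn_integral_restrict_space)
  finally show ?thesis .
qed

lemma filterlim_amplitude:
  assumes "0 < p" "0 < N" "0 < d"
  shows "filterlim (\<lambda>n. amplitude p N n / d) at_top sequentially"
proof -
  have "amplitude p N n / d = exp ((real n * (real N * ln 2) - ln (real n + 1)) / p - ln d)" for n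
    using assms(3) amplitude_pos[of p N n] by (simp add: ln_amplitude[symmetric] exp_diff)
  \<comment> \<open>A generic \<open>c\<close> > 0 stands for N ln 2, so that the linear term
    visibly beats the logarithm.\<close>
  moreover have "filterlim (\<lambda>n::nat. exp ((real n * c - ln (real n + 1)) / p - ln d)) at_top sequentially"
    if "0 < c" for c
    using assms(1) that by real_asymp
  ultimately show ?thesis
    using assms(2) by simp
qed

text \<open>The logarithm in \<open>\<phi>\<close> compensates exactly the loss \<open>1 / (n + 1)\<close> in \<^const>\<open>amplitude\<close>.\<close>

lemma eventually_phi_amplitude_ge:
  assumes "0 < p" "0 < N" "0 < d"
  shows "\<forall>\<^sub>F n in sequentially. real N * ln 2 / (2 * p) * d powr - p
    \<le> (amplitude p N n / d) powr p * ln (exp 1 + amplitude p N n / d) / 2 ^ (n * N)"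
proof -
  have "((\<lambda>n::nat. ((real n * c - ln (real n + 1)) / p - ln d) / (real n + 1)) \<longlongrightarrow> c / p) sequentially"
    for c
    using assms(1) by (real_asymp simp: field_simps)
  from this[of "real N * ln 2"]
  have lim: "((\<lambda>n. (ln (amplitude p N n) - ln d) / (real n + 1)) \<longlongrightarrow> real N * ln 2 / p) sequentially"
    by (simp add: ln_amplitude)
  \<comment> \<open>Half of the limit serves as a bound that is eventually exceeded.\<close>
  have "real N * ln 2 / (2 * p) < real N * ln 2 / p"
    using assms by (simp add: field_simps)
  from order_tendstoD(1)[OF lim this] show ?thesis
  proof eventually_elim
    case (elim n)
    let ?A = "amplitude p N n"
    have A: "0 < ?A"
      by (rule amplitude_pos)
    have "ln (?A / d) \<le> ln (exp 1 + ?A / d)"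
      using A assms(3) by (subst ln_le_cancel_iff) (auto intro: add_pos_pos)
    then have "ln ?A - ln d \<le> ln (exp 1 + ?A / d)"
      using A assms(3) by (simp add: ln_div)
    then have "(ln ?A - ln d) / (real n + 1) \<le> ln (exp 1 + ?A / d) / (real n + 1)"
      by (intro divide_right_mono) auto
    with elim have "real N * ln 2 / (2 * p) \<le> ln (exp 1 + ?A / d) / (real n + 1)"
      by linarith
    then have "real N * ln 2 / (2 * p) * d powr - p
        \<le> ln (exp 1 + ?A / d) / (real n + 1) * d powr - p"
      by (intro mult_right_mono) auto
    also have "ln (exp 1 + ?A / d) / (real n + 1) * d powr - p
        = (?A / d) powr p * ln (exp 1 + ?A / d) / 2 ^ (n * N)"
    proof -
      have "(?A / d) powr p = 2 ^ (n * N) / (real n + 1) * d powr - p"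
        using A assms by (simp add: powr_divide amplitude_powr powr_minus_divide)
      then show ?thesis
        by simp
    qed
    finally show ?case .
  qed
qed

lemma dyadic_ball_antimono: "m \<le> n \<Longrightarrow> ball a (1 / 2 ^ n) \<subseteq> ball a (1 / 2 ^ m)"
  by (intro subset_ball divide_left_mono power_increasing) auto

text \<open>The factors record the losses: the volume of the half-radius ball, half the limit in
  \<open>eventually_phi_amplitude_ge\<close>, and 2^-p for the half height.\<close>

definition bump_gap :: "real \<Rightarrow> nat \<Rightarrow> real" where
  "bump_gap p N = unit_ball_vol (real N) / 2 ^ N * (real N * ln 2 / (2 * p)) * 2 powr - p"

lemma bump_gap_pos: "0 < p \<Longrightarrow> 0 < N \<Longrightarrow> 0 < bump_gap p N"
  by (auto simp: bump_gap_def intro!: mult_pos_pos divide_pos_pos)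

text \<open>Serves both claims: R = 1 for \<open>\<phi>\<close>, and arbitrarily large
  \<open>R\<close> for \<open>\<gamma>\<close>. The explicit power of \<open>d\<close> allows
  \<open>R\<close> or \<open>d\<close> to be tuned until the bound equals 2.\<close>

lemma eventually_Orlicz_modular_bump_ge:
  fixes a :: "'a::euclidean_space" and f :: "real \<Rightarrow> real"
  assumes "0 < p" "0 \<le> R" "0 < d"
    and Phi: "Phi_function (\<lambda>t. ennreal (f t))"
    and f: "\<forall>\<^sub>F s in at_top. R * (s powr p * ln (exp 1 + s)) \<le> f s"
    and \<Omega>: "\<Omega> \<in> sets lebesgue" "ball a (1 / 2 ^ m) \<subseteq> \<Omega>"
  shows "\<forall>\<^sub>F n in sequentially. ennreal (R * bump_gap p DIM('a) * d powr - p)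
    \<le> Orlicz_modular (\<lambda>t. ennreal (f t)) \<Omega> (\<lambda>x. bump p a n x / d)"
proof -
  let ?N = "DIM('a)"
  let ?V = "unit_ball_vol (real ?N)" and ?K = "bump_gap p DIM('a)"
  have lim: "filterlim (\<lambda>n. amplitude p ?N n / (2 * d)) at_top sequentially"
    using assms(1,3) by (intro filterlim_amplitude) auto
  have ev: "\<forall>\<^sub>F n in sequentially. real ?N * ln 2 / (2 * p) * (2 * d) powr - p
      \<le> (amplitude p ?N n / (2 * d)) powr p * ln (exp 1 + amplitude p ?N n / (2 * d)) / 2 ^ (n * ?N)"
    using assms(1,3) by (intro eventually_phi_amplitude_ge) auto
  from eventually_compose_filterlim[OF f lim] ev eventually_ge_at_top[of m] show ?thesis
  proof eventually_elim
    case (elim n)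
    let ?s = "amplitude p ?N n / (2 * d)"
    have sub: "ball a (1 / 2 ^ n) \<subseteq> \<Omega>"
      using dyadic_ball_antimono[OF elim(3), of a] \<Omega>(2) by blast
    have "R * ?K * d powr - p
        = R * (?V / 2 ^ ?N) * (real ?N * ln 2 / (2 * p) * (2 * d) powr - p)"
      using assms(3) by (simp add: bump_gap_def powr_mult mult_ac)
    also have "\<dots> \<le> R * (?V / 2 ^ ?N) * (?s powr p * ln (exp 1 + ?s) / 2 ^ (n * ?N))"
      using assms(2) by (intro mult_left_mono elim(2)) auto
    also have "\<dots> = R * (?s powr p * ln (exp 1 + ?s)) * (?V / 2 ^ (Suc n * ?N))"
      by (simp add: power_add)
    also have "\<dots> \<le> f ?s * (?V / 2 ^ (Suc n * ?N))"
      by (intro mult_right_mono elim(1)) auto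
    finally have "ennreal (R * ?K * d powr - p) \<le> ennreal (f ?s * (?V / 2 ^ (Suc n * ?N)))"
      by (rule ennreal_leI)
    also have "\<dots> = ennreal (f ?s) * ennreal (?V / 2 ^ (Suc n * ?N))"
      by (rule ennreal_mult'') simp
    also have "\<dots> \<le> Orlicz_modular (\<lambda>t. ennreal (f t)) \<Omega> (\<lambda>x. bump p a n x / d)"
      by (rule Orlicz_modular_bump_ge[OF Phi \<Omega>(1) sub assms(3)])
    finally show ?case .
  qed
qed

section \<open>Failure of the two embeddings\<close>

lemma exists_dyadic_ball_subset:
  fixes a :: "'a::metric_space"
  assumes "open \<Omega>" "a \<in> \<Omega>"
  obtains m :: nat where "ball a (1 / 2 ^ m) \<subseteq> \<Omega>"
proof -
  obtain r where r: "0 < r" "ball a r \<subseteq> \<Omega>"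
    using assms by (meson open_contains_ball)
  obtain m :: nat where "(1 / 2) ^ m < r"
    using real_arch_pow_inv[of r "1 / 2"] r by auto
  then have "ball a (1 / 2 ^ m) \<subseteq> ball a r"
    by (intro subset_ball) (simp add: power_one_over)
  then show ?thesis
    using that r(2) by blast
qed

lemma one_le_ln_exp_1_add: "0 \<le> t \<Longrightarrow> 1 \<le> ln (exp 1 + t :: real)"
  by (subst ln_ge_iff) (auto intro: add_pos_nonneg)

text \<open>Boundedness would put the Luxemburg norms of all bumps inside the domain below one
  \<open>d\<close>, hence their modulars at scale \<open>d\<close> below 1. Superlogarithmic growth
  allows an \<open>R\<close> for which these modulars eventually reach 2.\<close>

lemma not_continuously_embedded_superlog:
  fixes \<Omega> :: "'a::euclidean_space set" and f :: "real \<Rightarrow> real"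
  assumes "1 < p" "open \<Omega>" "\<Omega> \<noteq> {}" "bounded \<Omega>"
    and "convex_Phi_function (\<lambda>t. ennreal (f t))"
    and f: "\<And>R. \<forall>\<^sub>F s in at_top. R * (s powr p * ln (exp 1 + s)) \<le> f s"
  shows "\<not> continuously_embedded (X_space p \<Omega>) (X_norm p \<Omega>)
    (Orlicz_space (\<lambda>t. ennreal (f t)) \<Omega>) (Luxemburg_norm (\<lambda>t. ennreal (f t)) \<Omega>)"
proof
  let ?\<theta> = "\<lambda>t. ennreal (f t)"
  assume "continuously_embedded (X_space p \<Omega>) (X_norm p \<Omega>) (Orlicz_space ?\<theta> \<Omega>) (Luxemburg_norm ?\<theta> \<Omega>)"
  then obtain C where C: "\<And>u. u \<in> X_space p \<Omega> \<Longrightarrow> Luxemburg_norm ?\<theta> \<Omega> u \<le> C * X_norm p \<Omega> u"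
    by (auto simp: continuously_embedded_def)
  have p: "0 < p"
    using assms(1) by simp
  have \<Omega>: "\<Omega> \<in> sets lebesgue"
    using assms(2) by auto
  have Phi: "Phi_function ?\<theta>"
    using assms(5) by (rule convex_Phi_function_imp_Phi)
  obtain a where "a \<in> \<Omega>"
    using assms(3) by blast
  with assms(2) obtain m where m: "ball a (1 / 2 ^ m) \<subseteq> \<Omega>"
    by (rule exists_dyadic_ball_subset)
  obtain M where M: "0 \<le> M" "\<And>n. X_norm p \<Omega> (bump p a n) \<le> M"
    using bump_X_norm_le[OF assms(1) \<Omega>] by metis
  let ?K = "bump_gap p DIM('a)"
  have K: "0 < ?K"
    using assms(1) by (intro bump_gap_pos) auto
  \<comment> \<open>The summand 1 makes the norm bound strict, as \<open>Orlicz_modular_le_1\<close>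
    requires; the absolute value covers a negative \<open>C\<close>.\<close>
  define d where "d = \<bar>C\<bar> * M + 1"
  define R where "R = 2 / (?K * d powr - p)"
  have d: "0 < d"
    using M(1) by (simp add: d_def add_nonneg_pos)
  have R: "0 \<le> R" "R * ?K * d powr - p = 2"
    using K d by (auto simp: R_def)
  obtain n where n: "m \<le> n" "ennreal 2 \<le> Orlicz_modular ?\<theta> \<Omega> (\<lambda>x. bump p a n x / d)"
    using eventually_happens'[OF sequentially_bot
        eventually_conj[OF eventually_ge_at_top[of m]
          eventually_Orlicz_modular_bump_ge[OF p R(1) d Phi f \<Omega> m]]]
    by (auto simp: R(2))
  have "ball a (1 / 2 ^ n) \<subseteq> \<Omega>"
    using dyadic_ball_antimono[OF n(1), of a] m by blast
  then have X: "bump p a n \<in> X_space p \<Omega>"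
    by (intro bump_in_X_space assms(1) \<Omega>)
  have "C * X_norm p \<Omega> (bump p a n) \<le> \<bar>C\<bar> * M"
    using M by (intro mult_mono) (auto simp: X_norm_def)
  then have "Luxemburg_norm ?\<theta> \<Omega> (bump p a n) < d"
    using C[OF X] by (simp add: d_def)
  then have "Orlicz_modular ?\<theta> \<Omega> (\<lambda>x. bump p a n x / d) \<le> 1"
    by (intro Orlicz_modular_le_1 bump_in_Orlicz_space assms Phi \<Omega>)
  with n(2) have "ennreal 2 \<le> 1"
    by (rule order_trans)
  then show False
    by simp
qed

text \<open>A limit \<open>v\<close> of a subsequence of bumps at \<open>a\<close> would vanish off every ball around \<open>a\<close>, hence
  almost everywhere, although the modulars of the bumps are bounded away from \<open>0\<close>.\<close>

lemma not_compactly_embedded_log: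
  fixes \<Omega> :: "'a::euclidean_space set" and f :: "real \<Rightarrow> real"
  assumes "1 < p" "open \<Omega>" "\<Omega> \<noteq> {}" "bounded \<Omega>"
    and "convex_Phi_function (\<lambda>t. ennreal (f t))"
    and f: "\<And>t. 0 \<le> t \<Longrightarrow> f t = t powr p * ln (exp 1 + t)"
  shows "\<not> compactly_embedded (X_space p \<Omega>) (X_norm p \<Omega>)
    (Orlicz_space (\<lambda>t. ennreal (f t)) \<Omega>) (Luxemburg_norm (\<lambda>t. ennreal (f t)) \<Omega>)"
proof
  let ?\<theta> = "\<lambda>t. ennreal (f t)"
  assume compact: "compactly_embedded (X_space p \<Omega>) (X_norm p \<Omega>)
    (Orlicz_space ?\<theta> \<Omega>) (Luxemburg_norm ?\<theta> \<Omega>)"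
  have p: "0 < p"
    using assms(1) by simp
  have \<Omega>: "\<Omega> \<in> sets lebesgue"
    using assms(2) by auto
  have Phi: "Phi_function ?\<theta>"
    using assms(5) by (rule convex_Phi_function_imp_Phi)
  obtain a where "a \<in> \<Omega>"
    using assms(3) by blast
  with assms(2) obtain m where m: "ball a (1 / 2 ^ m) \<subseteq> \<Omega>"
    by (rule exists_dyadic_ball_subset)
  obtain M where M: "\<And>n. X_norm p \<Omega> (bump p a n) \<le> M"
    using bump_X_norm_le[OF assms(1) \<Omega>] by metis
  \<comment> \<open>Starting the sequence at index \<open>m\<close> puts every supporting ball
    inside the domain.\<close>
  have "ball a (1 / 2 ^ (m + k)) \<subseteq> \<Omega>" for k
    using dyadic_ball_antimono[of m "m + k" a] m by auto
  then have X: "bump p a (m + k) \<in> X_space p \<Omega>" for k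
    by (intro bump_in_X_space assms(1) \<Omega>)
  have "\<exists>r v. strict_mono (r :: nat \<Rightarrow> nat) \<and> v \<in> Orlicz_space ?\<theta> \<Omega> \<and>
      (\<lambda>k. Luxemburg_norm ?\<theta> \<Omega> (\<lambda>x. bump p a (m + r k) x - v x)) \<longlonglongrightarrow> 0"
    using compact[unfolded compactly_embedded_def, THEN conjunct2, rule_format,
        of "\<lambda>k. bump p a (m + k)"] X M by blast
  then obtain r v where r: "strict_mono (r :: nat \<Rightarrow> nat)" and v: "v \<in> Orlicz_space ?\<theta> \<Omega>"
    and lim: "(\<lambda>k. Luxemburg_norm ?\<theta> \<Omega> (\<lambda>x. bump p a (m + r k) x - v x)) \<longlonglongrightarrow> 0"
    by blast
  define w where "w k x = bump p a (m + r k) x - v x" for k x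
  have w: "w k \<in> Orlicz_space ?\<theta> \<Omega>" for k
    unfolding w_def by (intro Orlicz_space_diff bump_in_Orlicz_space Phi \<Omega> assms(4) v)
  have [measurable]: "v \<in> borel_measurable (lebesgue_on \<Omega>)"
    "w k \<in> borel_measurable (lebesgue_on \<Omega>)" for k
    using v w[of k] by (auto simp: Orlicz_space_def)
  have small: "\<forall>\<^sub>F k in sequentially. Orlicz_modular ?\<theta> \<Omega> (\<lambda>x. w k x / d) \<le> 1" if "0 < d" for d
    using order_tendstoD(2)[OF lim that]
    by eventually_elim (intro Orlicz_modular_le_1 assms(5) w, simp add: w_def[abs_def])
  \<comment> \<open>Late bumps vanish off the ball, so there |w k| = |v|. As the logarithm is at
    least 1, f t >= t^p, and modular at most 1 at scale \<open>d\<close> bounds the integral of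
    |v|^p off the ball by d^p, which is arbitrarily small.\<close>
  have off_ball: "AE x in lebesgue_on \<Omega>. x \<notin> ball a (1 / 2 ^ j) \<longrightarrow> v x = 0" for j
  proof -
    have B: "\<Omega> \<inter> - ball a (1 / 2 ^ j) \<in> sets (lebesgue_on \<Omega>)"
      using \<Omega> by (auto simp: sets_restrict_space)
    let ?h = "\<lambda>x. ennreal (\<bar>v x\<bar> powr p) * indicator (\<Omega> \<inter> - ball a (1 / 2 ^ j)) x"
    have "(\<integral>\<^sup>+x. ?h x \<partial>lebesgue_on \<Omega>) \<le> 0"
    proof (rule ennreal_le_epsilon)
      fix e :: real assume e: "0 < e"
      define d where "d = e powr (1 / p)"
      have d: "0 < d" "d powr p = e"
        using e assms(1) by (auto simp: d_def powr_powr)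
      obtain k where k: "j \<le> k" "Orlicz_modular ?\<theta> \<Omega> (\<lambda>x. w k x / d) \<le> 1"
        using eventually_happens'[OF sequentially_bot
            eventually_conj[OF eventually_ge_at_top[of j] small[OF d(1)]]] by auto
      have "j \<le> m + r k"
        using k(1) seq_suble[OF r, of k] by linarith
      then have zero: "bump p a (m + r k) x = 0" if "x \<notin> ball a (1 / 2 ^ j)" for x
        using that dyadic_ball_antimono by (intro bump_eq_0) blast
      have meas: "(\<lambda>x. ?\<theta> \<bar>w k x / d\<bar>) \<in> borel_measurable (lebesgue_on \<Omega>)"
        by (intro Phi_function_measurable_abs Phi) measurable
      have "(\<integral>\<^sup>+x. ?h x \<partial>lebesgue_on \<Omega>) \<le> (\<integral>\<^sup>+x. ennreal e * ?\<theta> \<bar>w k x / d\<bar> \<partial>lebesgue_on \<Omega>)"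
      proof (intro nn_integral_mono)
        fix x
        show "?h x \<le> ennreal e * ?\<theta> \<bar>w k x / d\<bar>"
        proof (cases "x \<in> \<Omega> \<inter> - ball a (1 / 2 ^ j)")
          case True
          define t where "t = \<bar>v x\<bar> / d"
          have t: "0 \<le> t" "\<bar>w k x / d\<bar> = t"
            using True zero[of x] d(1) by (auto simp: t_def w_def)
          have "\<bar>v x\<bar> powr p = e * t powr p"
            using d e by (simp add: t_def powr_divide)
          also have "\<dots> \<le> e * f t"
            using e t one_le_ln_exp_1_add[of t] mult_left_mono[of 1 "ln (exp 1 + t)" "t powr p"]
            by (simp add: f)
          finally have "ennreal (\<bar>v x\<bar> powr p) \<le> ennreal e * ennreal (f t)"
            using e by (simp add: ennreal_mult'[symmetric] ennreal_leI)
          then show ?thesis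
            unfolding t(2) using True by simp
        qed simp
      qed
      also have "\<dots> = ennreal e * Orlicz_modular ?\<theta> \<Omega> (\<lambda>x. w k x / d)"
        unfolding Orlicz_modular_def by (rule nn_integral_cmult[OF meas])
      also have "\<dots> \<le> ennreal e * 1"
        by (intro mult_left_mono k(2)) simp
      finally show "(\<integral>\<^sup>+x. ?h x \<partial>lebesgue_on \<Omega>) \<le> 0 + ennreal e"
        by simp
    qed
    then have "(\<integral>\<^sup>+x. ?h x \<partial>lebesgue_on \<Omega>) = 0"
      by simp
    moreover have "?h \<in> borel_measurable (lebesgue_on \<Omega>)"
      using B by measurable
    ultimately have "AE x in lebesgue_on \<Omega>. ?h x = 0"
      by (simp add: nn_integral_0_iff_AE)
    with AE_space show ?thesis
    proof eventually_elim
      case (elim x)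
      then show ?case
        by (auto simp: indicator_def ennreal_eq_0_iff split: if_splits)
    qed
  qed
  \<comment> \<open>The centre lies in every ball and must be discarded as a null set.\<close>
  have "AE x in lebesgue_on \<Omega>. x \<noteq> a"
    using \<Omega> AE_completion[OF AE_lborel_singleton[of a]] by (auto simp: AE_restrict_space_iff)
  moreover have "AE x in lebesgue_on \<Omega>. \<forall>j. x \<notin> ball a (1 / 2 ^ j) \<longrightarrow> v x = 0"
    unfolding AE_all_countable using off_ball by blast
  ultimately have v0: "AE x in lebesgue_on \<Omega>. v x = 0"
  proof eventually_elim
    case (elim x)
    obtain j :: nat where "(1 / 2) ^ j < dist a x"
      using real_arch_pow_inv[of "dist a x" "1 / 2"] elim(1) by auto
    then have "x \<notin> ball a (1 / 2 ^ j)"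
      by (simp add: power_one_over)
    then show ?case
      using elim(2) by blast
  qed
  let ?K = "bump_gap p DIM('a)"
  have K: "0 < ?K"
    using assms(1) by (intro bump_gap_pos) auto
  \<comment> \<open>Solves K d^-p = 2, so the lower bound for the modulars exceeds the upper bound
    1.\<close>
  define d where "d = (2 / ?K) powr (- 1 / p)"
  have d: "0 < d" "1 * ?K * d powr - p = 2"
    using K assms(1) by (auto simp: d_def powr_powr)
  have "\<forall>\<^sub>F s in at_top. 1 * (s powr p * ln (exp 1 + s)) \<le> f s"
    using eventually_ge_at_top[of 0] by eventually_elim (simp add: f)
  from eventually_Orlicz_modular_bump_ge[OF p zero_le_one d(1) Phi this \<Omega> m]
  have "\<forall>\<^sub>F n in sequentially. ennreal 2 \<le> Orlicz_modular ?\<theta> \<Omega> (\<lambda>x. bump p a n x / d)"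
    by (simp only: d(2))
  moreover have "filterlim (\<lambda>k. m + r k) sequentially sequentially"
    using filterlim_subseq[OF r] filterlim_at_top_mono by fastforce
  ultimately have "\<forall>\<^sub>F k in sequentially. ennreal 2 \<le> Orlicz_modular ?\<theta> \<Omega> (\<lambda>x. bump p a (m + r k) x / d)"
    by (rule eventually_compose_filterlim)
  with small[OF d(1)] have "\<forall>\<^sub>F k in sequentially. False"
  proof eventually_elim
    case (elim k)
    \<comment> \<open>With v = 0 almost everywhere, the differences have the modulars of the bumps,
      which cannot be both at most 1 and at least 2.\<close>
    have "Orlicz_modular ?\<theta> \<Omega> (\<lambda>x. w k x / d) = Orlicz_modular ?\<theta> \<Omega> (\<lambda>x. bump p a (m + r k) x / d)"
      unfolding Orlicz_modular_def using v0 by (intro nn_integral_cong_AE) (auto simp: w_def)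
    with elim have "ennreal 2 \<le> 1"
      by (metis order_trans)
    then show False
      by simp
  qed
  then show False
    by simp
qed

theorem theorem2p10:
  fixes p :: real and \<Omega> :: "'a::euclidean_space set" and \<phi> \<gamma> :: "real \<Rightarrow> real"
  assumes "1 < p"
    and "open \<Omega>" and "\<Omega> \<noteq> {}" and "bounded \<Omega>" and "convex \<Omega>"
    and "\<forall>t\<ge>0. 0 \<le> \<phi> t" and "convex_Phi_function (\<lambda>t. ennreal (\<phi> t))"
    and "\<forall>t\<ge>0. 0 \<le> \<gamma> t" and "convex_Phi_function (\<lambda>t. ennreal (\<gamma> t))"
    and "\<forall>t\<ge>0. \<phi> t = t powr p * ln (exp 1 + t)"
    and "\<exists>\<beta>>0. filterlim (\<lambda>l. \<gamma> (l * \<beta>) / \<phi> (l * \<beta>)) at_top at_top"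
  shows "\<not> compactly_embedded (X_space p \<Omega>) (X_norm p \<Omega>)
             (Orlicz_space (\<lambda>t. ennreal (\<phi> t)) \<Omega>) (Luxemburg_norm (\<lambda>t. ennreal (\<phi> t)) \<Omega>)
       \<and> \<not> continuously_embedded (X_space p \<Omega>) (X_norm p \<Omega>)
             (Orlicz_space (\<lambda>t. ennreal (\<gamma> t)) \<Omega>) (Luxemburg_norm (\<lambda>t. ennreal (\<gamma> t)) \<Omega>)"
proof
  show "\<not> compactly_embedded (X_space p \<Omega>) (X_norm p \<Omega>)
      (Orlicz_space (\<lambda>t. ennreal (\<phi> t)) \<Omega>) (Luxemburg_norm (\<lambda>t. ennreal (\<phi> t)) \<Omega>)"
    using assms by (intro not_compactly_embedded_log) auto
  obtain \<beta> where \<beta>: "0 < \<beta>" "filterlim (\<lambda>l. \<gamma> (l * \<beta>) / \<phi> (l * \<beta>)) at_top at_top"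
    using assms(11) by blast
  \<comment> \<open>The substitution l = s / \<open>\<beta>\<close> removes \<open>\<beta>\<close>
    from the growth hypothesis.\<close>
  have "filterlim (\<lambda>s. s / \<beta>) at_top at_top"
    using \<beta>(1) by real_asymp
  from filterlim_compose[OF \<beta>(2) this] have "filterlim (\<lambda>s. \<gamma> s / \<phi> s) at_top at_top"
    using \<beta>(1) by simp
  then have large: "\<forall>\<^sub>F s in at_top. R \<le> \<gamma> s / \<phi> s" for R
    by (simp add: filterlim_at_top)
  have "\<forall>\<^sub>F s in at_top. R * (s powr p * ln (exp 1 + s)) \<le> \<gamma> s" for R
    using large[of R] eventually_gt_at_top[of 0]
  proof eventually_elim
    case (elim s)
    have "0 < s powr p * ln (exp 1 + s)"
      using elim(2) one_le_ln_exp_1_add[of s] by (intro mult_pos_pos) auto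
    then show ?case
      using elim assms(10) by (simp add: pos_le_divide_eq)
  qed
  then show "\<not> continuously_embedded (X_space p \<Omega>) (X_norm p \<Omega>)
      (Orlicz_space (\<lambda>t. ennreal (\<gamma> t)) \<Omega>) (Luxemburg_norm (\<lambda>t. ennreal (\<gamma> t)) \<Omega>)"
    using assms by (intro not_continuously_embedded_superlog) auto
qed

end
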